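(* Let $x\in\mathcal{D}_n$ with $x\ne 0$, and let $1\le m\le n$ be such that $x_1\ge\dots\ge x_m>0=x_{m+1}=\dots=x_n$. Then a vector $B=(B_1,\dots,B_n)\in\mathbb{R}^n$ belongs to $\overline{C_\Psi(x)}$ if and only if both of the following hold: (1) $B_m\le B_{m+1}=\dots=B_n$ (a vacuous condition when $m=n$); (2) the matrix $$\begin{bmatrix}1&1&1\\ B_i&B_j&B_k\\ \frac1{x_i}&\frac1{x_j}&\frac1{x_k}\end{bmatrix}$$ is totally positive whenever $1\le i\le j\le k\le m$.
   Context: $\mathcal{D}_n=\{x\in\mathbb{R}^n: x_1\ge\dots\ge x_n\ge0\}$. A matrix is totally positive if all of its subdeterminants (minors of all sizes) are nonnegative. For $\lambda>0$ and $x\in\mathbb{R}^n$, $\Psi_\lambda(x)=\sum_{i=1}^n\left(\min(x_i,\lambda)+\lambda\log_+(x_i/\lambda)\right)$, where $\log_+(s)=0$ for $s\in(-\infty,1]$ and $\log_+(s)=\log s$ for $s\ge1$; each $\Psi_\lambda$ is $C^1$ on $\mathbb{R}^n$. $C_\Psi(x)=\{c_1\nabla\Psi_{\lambda_1}(x)+\dots+c_k\nabla\Psi_{\lambda_k}(x): k\in\mathbb{N},\ c_i\ge0,\ \lambda_i>0\}$, and $\overline{C_\Psi(x)}$ is its closure in $\mathbb{R}^n$. *)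

theory Defs
  imports
    "HOL-Analysis.Analysis"
    "Jordan_Normal_Form.Determinant"
    "Jordan_Normal_Form.DL_Submatrix"
begin

no_notation vec_index (infixl "$" 100)

text \<open>
  Coordinates \<open>1, \<dots>, n\<close> are indexed by a type \<open>'n\<close> that is finite and linearly
  ordered, so \<open>n = CARD('n)\<close> and the order of \<open>'n\<close> is the order of the coordinates.
\<close>

definition D_cone :: "(real ^ 'n::{finite,linorder}) set" where
  "D_cone = {x. (\<forall>i j. i \<le> j \<longrightarrow> x $ j \<le> x $ i) \<and> (\<forall>i. 0 \<le> x $ i)}"

definition log_plus :: "real \<Rightarrow> real" where
  "log_plus s = (if s \<le> 1 then 0 else ln s)"

definition Psi :: "real \<Rightarrow> real ^ 'n::finite \<Rightarrow> real" where
  "Psi l x = (\<Sum>i\<in>UNIV. min (x $ i) l + l * log_plus (x $ i / l))"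

definition gradient :: "('a::real_inner \<Rightarrow> real) \<Rightarrow> 'a \<Rightarrow> 'a" where
  "gradient f x = (THE D. GDERIV f x :> D)"

lemma gradient_eq:
  assumes "GDERIV f x :> D"
  shows "gradient f x = D"
  unfolding gradient_def
proof (rule the_equality, rule assms)
  fix E
  assume "GDERIV f x :> E"
  then have "(\<lambda>h. inner h E) = (\<lambda>h. inner h D)"
    using assms has_derivative_unique unfolding gderiv_def by blast
  then have "inner (E - D) E = inner (E - D) D"
    by metis
  then have "inner (E - D) (E - D) = 0"
    by (simp only: inner_diff_right diff_self)
  then show "E = D"
    by simp
qed

definition C_Psi :: "real ^ 'n::finite \<Rightarrow> (real ^ 'n) set" where
  "C_Psi x = {\<Sum>i<k. c i *\<^sub>R gradient (Psi (l i)) x | (k::nat) (c::nat \<Rightarrow> real) (l::nat \<Rightarrow> real).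
     (\<forall>i<k. 0 \<le> c i \<and> 0 < l i)}"

text \<open>
  The matrices here are indexed by natural numbers, because the order of the numeral type
  \<open>3\<close> is \<open>3 = 0 < 1 < 2\<close>, which would permute the rows and columns of minors of
  matrices of type \<open>real ^ 3 ^ 3\<close>.
\<close>

definition totally_positive :: "real mat \<Rightarrow> bool" where
  "totally_positive A \<longleftrightarrow>
     (\<forall>I J. I \<subseteq> {..<dim_row A} \<longrightarrow> J \<subseteq> {..<dim_col A} \<longrightarrow> card I = card J \<longrightarrow>
        0 \<le> Determinant.det (submatrix A I J))"

end

theory Submission
  imports Defs
begin

text \<open>
  Put \<open>y\<^sub>i = 1 / x\<^sub>i\<close> for \<open>i \<le> m\<close>, so that \<open>0 < y\<^sub>1 \<le> \<dots> \<le> y\<^sub>m\<close>. The gradient of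
  \<open>\<Psi>\<^sub>\<lambda>\<close> at \<open>x\<close> has the entry \<open>min 1 (\<lambda> y\<^sub>i)\<close> at \<open>i \<le> m\<close> and the entry \<open>1\<close>, the limit of
  \<open>min 1 (\<lambda> s)\<close> as \<open>s\<close> tends to infinity, at \<open>i > m\<close>. Hence an element of the cone has the form
  \<open>B\<^sub>i = g y\<^sub>i\<close> for \<open>i \<le> m\<close> and \<open>B\<^sub>i = g(\<infinity>)\<close> for \<open>i > m\<close>, where \<open>g\<close> is a bounded nondecreasing
  concave function on the half line with \<open>g 0 = 0\<close>.

  Total positivity says the same thing about finitely many nodes. The \<open>1 \<times> 1\<close> minors in the row
  of \<open>B\<close> express that \<open>g \<ge> 0\<close>, the \<open>2 \<times> 2\<close> minors with the rows of \<open>1\<close> and \<open>B\<close> that \<open>g\<close> is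
  nondecreasing, those with the rows of \<open>B\<close> and \<open>y\<close> that \<open>g s / s\<close> is nonincreasing, which is
  concavity for triples of nodes that start at \<open>0\<close>, and the determinant is concavity for triples of
  positive nodes (\<open>totally_positive_concave_iff\<close>). All other minors are nonnegative because \<open>y\<close> is
  positive and nondecreasing. The conditions on \<open>B\<close> are weak linear inequalities, and each
  gradient satisfies them, so they hold on the closed cone
  (\<open>closure_C_Psi_imp_concave_profile\<close>).

  Conversely, a nondecreasing concave function on finitely many nodes with \<open>g 0 = 0\<close> is a
  nonnegative combination of the functions \<open>s \<mapsto> min 1 (s / t)\<close> with \<open>t\<close> among the nodes
  (\<open>concave_eq_sum_min\<close>). This gives an element of the cone that agrees with \<open>B\<close> up to \<open>m\<close> and
  equals \<open>B\<^sub>m\<close> afterwards. The remaining jump from \<open>B\<^sub>m\<close> to the constant value on the zero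
  coordinates of \<open>x\<close> is a multiple of the limit of \<open>\<nabla>\<Psi>\<^sub>\<lambda>(x)\<close> for \<open>\<lambda> \<rightarrow> 0\<close>; this limit is the only
  place where the closure enters (\<open>concave_profile_imp_closure_C_Psi\<close>).
\<close>

section \<open>The gradients of the functions \<Psi>\<close>

text \<open>
  The two branches \<open>t\<close> and \<open>l + l * ln (t / l)\<close> have the common value \<open>l\<close> and the common slope \<open>1\<close>
  at \<open>t = l\<close>, so their derivatives can be glued.
\<close>

lemma psi_has_field_derivative:
  fixes l t :: real
  assumes l: "0 < l"
  shows "((\<lambda>t. min t l + l * log_plus (t / l)) has_field_derivative
           (if t \<le> l then 1 else l / t)) (at t)"
proof -
  have *: "((\<lambda>t. if t \<in> {..l} then t else l + l * ln (t / l)) has_vector_derivative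
           (if t \<in> {..l} then 1 else l / t)) (at t within UNIV)"
  proof (rule has_vector_derivative_If_within_closures[where T = "{l<..}"])
    assume "t \<in> {l<..} \<union> closure {..l} \<inter> closure {l<..}"
    then have t: "0 < t"
      using l by auto
    have "((\<lambda>t. l + l * ln (t / l)) has_field_derivative l / t) (at t)"
      using l t by (auto intro!: derivative_eq_intros simp: field_simps)
    then show "((\<lambda>t. l + l * ln (t / l)) has_vector_derivative l / t)
         (at t within {l<..} \<union> closure {..l} \<inter> closure {l<..})"
      by (metis has_real_derivative_iff_has_vector_derivative has_vector_derivative_at_within)
  qed (use l in \<open>auto intro!: derivative_eq_intros\<close>)
  have "(\<lambda>t. min t l + l * log_plus (t / l))
      = (\<lambda>t. if t \<in> {..l} then t else l + l * ln (t / l))"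
    using l by (auto simp: fun_eq_iff log_plus_def field_simps)
  with * show ?thesis
    by (simp add: has_real_derivative_iff_has_vector_derivative)
qed

lemma gradient_Psi:
  fixes x :: "real ^ 'n::finite"
  assumes l: "0 < l"
  shows "gradient (Psi l) x = (\<chi> i. if x $ i \<le> l then 1 else l / x $ i)"
proof (rule gradient_eq)
  have "((\<lambda>x::real^'n. min (x $ i) l + l * log_plus (x $ i / l)) has_derivative
      (\<lambda>h. (if x $ i \<le> l then 1 else l / x $ i) * h $ i)) (at x)" for i
    using has_derivative_compose[OF bounded_linear_imp_has_derivative[OF bounded_linear_vec_nth]
        psi_has_field_derivative[OF l, unfolded has_field_derivative_def]] .
  then have "((\<lambda>x. Psi l x) has_derivative
      (\<lambda>h. \<Sum>i\<in>UNIV. (if x $ i \<le> l then 1 else l / x $ i) * h $ i)) (at x)"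
    unfolding Psi_def by (rule has_derivative_sum)
  then show "GDERIV (Psi l) x :> (\<chi> i. if x $ i \<le> l then 1 else l / x $ i)"
    by (simp add: gderiv_def inner_vec_def mult.commute)
qed

text \<open>
  In the variable \<open>1 / x $ i\<close> the entries of all gradients become values of the concave functions
  \<open>s \<mapsto> min 1 (l * s)\<close>.
\<close>

lemma gradient_Psi_nth_pos:
  fixes x :: "real ^ 'n::finite"
  assumes "0 < l" "0 < x $ i"
  shows "gradient (Psi l) x $ i = min 1 (l * (1 / x $ i))"
  using assms by (simp add: gradient_Psi min_def field_simps)

lemma gradient_Psi_nth_zero:
  fixes x :: "real ^ 'n::finite"
  assumes "0 < l" "x $ i = 0"
  shows "gradient (Psi l) x $ i = 1"
  using assms by (simp add: gradient_Psi)

section \<open>The cone generated by the gradients\<close>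

lemma zero_mem_C_Psi: "0 \<in> C_Psi x"
  unfolding C_Psi_def by (auto intro!: exI[of _ "0::nat"])

lemma add_gradient_mem_C_Psi:
  assumes "v \<in> C_Psi x" "0 \<le> a" "0 < l"
  shows "v + a *\<^sub>R gradient (Psi l) x \<in> C_Psi x"
proof -
  obtain k c L where v: "v = (\<Sum>i<k. c i *\<^sub>R gradient (Psi (L i)) x)"
    and pos: "\<forall>i<(k::nat). 0 \<le> c i \<and> 0 < L i"
    using assms(1) unfolding C_Psi_def by blast
  have "(\<Sum>i<Suc k. (c(k := a)) i *\<^sub>R gradient (Psi ((L(k := l)) i)) x)
      = v + a *\<^sub>R gradient (Psi l) x"
    unfolding v by simp
  moreover have "\<forall>i<Suc k. 0 \<le> (c(k := a)) i \<and> 0 < (L(k := l)) i"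
    using pos assms by (auto simp: less_Suc_eq)
  ultimately show ?thesis
    unfolding C_Psi_def mem_Collect_eq
    by (intro exI[of _ "Suc k"] exI[of _ "c(k := a)"] exI[of _ "L(k := l)"]) simp
qed

lemma sum_gradient_mem_C_Psi:
  assumes "finite S" "\<And>t. t \<in> S \<Longrightarrow> 0 \<le> c t" "\<And>t. t \<in> S \<Longrightarrow> 0 < l t"
  shows "(\<Sum>t\<in>S. c t *\<^sub>R gradient (Psi (l t)) x) \<in> C_Psi x"
  using assms
proof (induction S rule: finite_induct)
  case empty
  show ?case
    by (simp add: zero_mem_C_Psi)
next
  case (insert t S)
  then show ?case
    using add_gradient_mem_C_Psi[of "\<Sum>t\<in>S. c t *\<^sub>R gradient (Psi (l t)) x" x "c t" "l t"]
    by (simp add: add.commute)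
qed

lemma C_Psi_induct [consumes 1, case_names zero add]:
  assumes "v \<in> C_Psi x"
    and "P 0"
    and step: "\<And>v a l. P v \<Longrightarrow> 0 \<le> a \<Longrightarrow> 0 < l \<Longrightarrow> P (v + a *\<^sub>R gradient (Psi l) x)"
  shows "P v"
proof -
  obtain k c L where v: "v = (\<Sum>i<k. c i *\<^sub>R gradient (Psi (L i)) x)"
    and pos: "\<forall>i<(k::nat). 0 \<le> c i \<and> 0 < L i"
    using assms(1) unfolding C_Psi_def by blast
  have "j \<le> k \<Longrightarrow> P (\<Sum>i<j. c i *\<^sub>R gradient (Psi (L i)) x)" for j
  proof (induction j)
    case 0
    show ?case
      using assms(2) by simp
  next
    case (Suc j)
    then have "P ((\<Sum>i<j. c i *\<^sub>R gradient (Psi (L i)) x) + c j *\<^sub>R gradient (Psi (L j)) x)"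
      using pos by (intro step) auto
    then show ?case
      by simp
  qed
  then show ?thesis
    unfolding v by simp
qed

section \<open>Total positivity of a matrix with three rows\<close>

lemma det_2_mat:
  fixes A :: "real mat"
  assumes "A \<in> carrier_mat 2 2"
  shows "Determinant.det A = A $$ (0,0) * A $$ (1,1) - A $$ (0,1) * A $$ (1,0)"
proof -
  have "Determinant.det (mat_delete A 0 j) = mat_delete A 0 j $$ (0,0)" for j
    using assms by (intro det_single) (auto simp: mat_delete_def)
  then show ?thesis
    using assms unfolding laplace_expansion_row[OF assms, of 0, simplified]
    by (simp add: numeral_2_eq_2 cofactor_def mat_delete_def)
qed

lemma det_3_mat:
  fixes A :: "real mat"
  assumes "A \<in> carrier_mat 3 3"
  shows "Determinant.det A =
      A $$ (0,0) * (A $$ (1,1) * A $$ (2,2) - A $$ (1,2) * A $$ (2,1))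
    - A $$ (0,1) * (A $$ (1,0) * A $$ (2,2) - A $$ (1,2) * A $$ (2,0))
    + A $$ (0,2) * (A $$ (1,0) * A $$ (2,1) - A $$ (1,1) * A $$ (2,0))"
proof -
  have "Determinant.det (mat_delete A 0 j) =
      mat_delete A 0 j $$ (0,0) * mat_delete A 0 j $$ (1,1)
    - mat_delete A 0 j $$ (0,1) * mat_delete A 0 j $$ (1,0)" for j
    using assms by (intro det_2_mat) (auto simp: mat_delete_def)
  then show ?thesis
    using assms unfolding laplace_expansion_row[OF assms, of 0, simplified]
    by (simp add: numeral_3_eq_3 numeral_2_eq_2 cofactor_def mat_delete_def)
      (simp only: mult_minus_right[symmetric] minus_diff_eq)
qed

lemma det_submatrix_1:
  fixes A :: "real mat"
  assumes "a < dim_row A" "c < dim_col A"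
  shows "Determinant.det (submatrix A {a} {c}) = A $$ (a, c)"
proof -
  have "{i. i < dim_row A \<and> i \<in> {a}} = {a}" "{i. i < dim_col A \<and> i \<in> {c}} = {c}"
    using assms by auto
  then have *: "card {i. i < dim_row A \<and> i \<in> {a}} = 1"
    "card {i. i < dim_col A \<and> i \<in> {c}} = 1"
    by auto
  then have "submatrix A {a} {c} \<in> carrier_mat 1 1"
    by (simp only: submatrix_def mat_carrier)
  moreover have "pick {b} 0 = b" for b
    by (auto intro!: Least_equality)
  ultimately show ?thesis
    by (simp only: det_single submatrix_index * zero_less_one)
qed

lemma pick_doubleton:
  assumes "a < b"
  shows "pick {a, b} 0 = a" "pick {a, b} 1 = b"
proof -
  show *: "pick {a, b} 0 = a"
    using assms by (auto intro!: Least_equality)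
  show "pick {a, b} 1 = b"
    using assms * by (auto intro!: Least_equality)
qed

lemma det_submatrix_2:
  fixes A :: "real mat"
  assumes "a < b" "b < dim_row A" "c < d" "d < dim_col A"
  shows "Determinant.det (submatrix A {a, b} {c, d}) =
    A $$ (a, c) * A $$ (b, d) - A $$ (a, d) * A $$ (b, c)"
proof -
  have "{i. i < dim_row A \<and> i \<in> {a, b}} = {a, b}"
    "{i. i < dim_col A \<and> i \<in> {c, d}} = {c, d}"
    using assms by auto
  then have *: "card {i. i < dim_row A \<and> i \<in> {a, b}} = 2"
    "card {i. i < dim_col A \<and> i \<in> {c, d}} = 2"
    using assms by auto
  then have "submatrix A {a, b} {c, d} \<in> carrier_mat 2 2"
    by (simp only: submatrix_def mat_carrier)
  then show ?thesis
    using pick_doubleton[OF assms(1)] pick_doubleton[OF assms(3)]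
    by (simp only: det_2_mat submatrix_index * zero_less_numeral one_less_numeral_iff
        semiring_norm)
qed

lemma submatrix_full:
  fixes A :: "real mat"
  assumes "A \<in> carrier_mat n n"
  shows "submatrix A {..<n} {..<n} = A"
proof (rule eq_matI)
  have "pick {..<n} i = i" if "i < n" for i
    using pick_reduce_set[of i n UNIV] that by (simp add: pick_UNIV lessThan_def)
  then show "submatrix A {..<n} {..<n} $$ (i, j) = A $$ (i, j)"
    if "i < dim_row A" "j < dim_col A" for i j
    using that assms by (simp add: submatrix_index)
qed (use assms in \<open>auto simp: dim_submatrix\<close>)

text \<open>
  A subset of the three indices of a given size is empty, a singleton, a pair or everything, which
  leaves the entries, the \<open>2 \<times> 2\<close> minors and the determinant; the empty minor is \<open>1\<close>.
\<close>

lemma totally_positive_3_iff: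
  assumes A: "A \<in> carrier_mat 3 3"
  shows "totally_positive A \<longleftrightarrow>
    (\<forall>a<3. \<forall>c<3. 0 \<le> A $$ (a, c)) \<and>
    (\<forall>b<3. \<forall>d<3. \<forall>a<b. \<forall>c<d. 0 \<le> A $$ (a, c) * A $$ (b, d) - A $$ (a, d) * A $$ (b, c)) \<and>
    0 \<le> Determinant.det A" (is "_ \<longleftrightarrow> ?R")
proof
  assume tp: "totally_positive A"
  have minor: "0 \<le> Determinant.det (submatrix A I J)"
    if "I \<subseteq> {..<3}" "J \<subseteq> {..<3}" "card I = card J" for I J
    using tp that A unfolding totally_positive_def by auto
  have "0 \<le> A $$ (a, c)" if "a < 3" "c < 3" for a c
    using minor[of "{a}" "{c}"] det_submatrix_1[of a A c] that A by auto
  moreover have "0 \<le> A $$ (a, c) * A $$ (b, d) - A $$ (a, d) * A $$ (b, c)"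
    if "b < 3" "d < 3" "a < b" "c < d" for a b c d
    using minor[of "{a, b}" "{c, d}"] det_submatrix_2[of a b A c d] that A by auto
  moreover have "0 \<le> Determinant.det A"
    using minor[of "{..<3}" "{..<3}"] submatrix_full[OF A] by simp
  ultimately show ?R
    by blast
next
  assume R: ?R
  have "0 \<le> Determinant.det (submatrix A I J)"
    if I: "I \<subseteq> {..<3}" and J: "J \<subseteq> {..<3}" and IJ: "card I = card J" for I J
  proof -
    have "card I \<le> 3"
      using card_mono[OF _ I] by simp
    then consider "card I = 0" | "card I = 1" | "card I = 2" | "card I = 3"
      by linarith
    then show ?thesis
    proof cases
      case 1
      with I J IJ have "I = {}" "J = {}"
        by (auto simp: finite_subset)
      then show ?thesis
        by (simp add: submatrix_def)
    next
      case 2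
      with IJ obtain a c where "I = {a}" "J = {c}"
        by (metis card_1_singletonE)
      then show ?thesis
        using R I J A by (simp add: det_submatrix_1)
    next
      case 3
      have pair: "\<exists>a b. a < b \<and> K = {a, b}" if "card K = 2" for K :: "nat set"
        using that unfolding card_2_iff by (metis insert_commute linorder_neqE_nat)
      obtain a b c d where "a < b" "I = {a, b}" "c < d" "J = {c, d}"
        using pair[of I] pair[of J] 3 IJ by auto
      then show ?thesis
        using R I J A by (simp add: det_submatrix_2)
    next
      case 4
      then have "I = {..<3}" "J = {..<3}"
        using card_subset_eq[of "{..<3::nat}" I] card_subset_eq[of "{..<3::nat}" J] I J IJ
        by simp_all
      then show ?thesis
        using R submatrix_full[OF A] by simp
    qed
  qed
  then show "totally_positive A"
    using A unfolding totally_positive_def by auto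
qed

text \<open>
  Each minor is read as a property of a function \<open>g\<close> with values \<open>a\<close>, \<open>b\<close>, \<open>c\<close> at the nodes \<open>p\<close>,
  \<open>q\<close>, \<open>r\<close>: sign, monotonicity, monotonicity of \<open>g s / s\<close>, and concavity. Slopes are compared
  after multiplication by the lengths of the intervals, so that nodes may coincide.
\<close>

lemma totally_positive_concave_iff:
  fixes a b c p q r :: real
  assumes "0 < p" "p \<le> q" "q \<le> r"
  shows "totally_positive (mat_of_rows_list 3 [[1, 1, 1], [a, b, c], [p, q, r]]) \<longleftrightarrow>
    (0 \<le> a \<and> a \<le> b \<and> b \<le> c) \<and> (b * p \<le> a * q \<and> c * p \<le> a * r \<and> c * q \<le> b * r) \<and>
    (c - b) * (q - p) \<le> (b - a) * (r - q)"
proof -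
  let ?A = "mat_of_rows_list 3 [[1, 1, 1], [a, b, c], [p, q, r]]"
  have A: "?A \<in> carrier_mat 3 3"
    by (simp add: mat_of_rows_list_def numeral_3_eq_3)
  have all3: "(\<forall>i<3. P i) \<longleftrightarrow> P 0 \<and> P 1 \<and> P 2" for P :: "nat \<Rightarrow> bool"
    by (auto simp: numeral_3_eq_3 numeral_2_eq_2 less_Suc_eq)
  have all2: "(\<forall>i<2. P i) \<longleftrightarrow> P 0 \<and> P 1" for P :: "nat \<Rightarrow> bool"
    by (auto simp: numeral_2_eq_2 less_Suc_eq)
  have ent: "?A $$ (0, 0) = 1" "?A $$ (0, 1) = 1" "?A $$ (0, 2) = 1"
    "?A $$ (1, 0) = a" "?A $$ (1, 1) = b" "?A $$ (1, 2) = c"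
    "?A $$ (2, 0) = p" "?A $$ (2, 1) = q" "?A $$ (2, 2) = r"
    by (simp_all add: mat_of_rows_list_def)
  show ?thesis
    unfolding totally_positive_3_iff[OF A] det_3_mat[OF A] all3 all2 ent less_one not_less_zero
    using assms by (auto simp: all2 ent[simplified] algebra_simps)
qed

section \<open>Concave functions on finite sets\<close>

lemma min_linear_concave:
  fixes l p q r :: real
  assumes "0 < l" "p \<le> q" "q \<le> r"
  shows "(min 1 (l * r) - min 1 (l * q)) * (q - p) \<le> (min 1 (l * q) - min 1 (l * p)) * (r - q)"
proof (cases "l * q \<le> 1")
  case True
  have lp: "l * p \<le> l * q"
    using assms by simp
  have "(min 1 (l * r) - min 1 (l * q)) * (q - p) \<le> (l * r - l * q) * (q - p)"
    using assms True by (intro mult_right_mono) auto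
  also have "\<dots> = (min 1 (l * q) - min 1 (l * p)) * (r - q)"
    using True lp by (simp add: algebra_simps)
  finally show ?thesis .
next
  case False
  moreover have "l * q \<le> l * r"
    using assms by simp
  ultimately have "min 1 (l * q) = 1" "min 1 (l * r) = 1"
    by auto
  then show ?thesis
    using assms by simp
qed

text \<open>
  Induction on the largest node \<open>M\<close>. Let \<open>\<sigma>\<close> be the slope of \<open>g\<close> on the last interval, from the
  preceding node \<open>p\<close> (possibly \<open>0\<close>) to \<open>M\<close>. On all nodes \<open>\<sigma> * s\<close> equals
  \<open>\<sigma> * M * min 1 (s / M)\<close>, a nonnegative multiple of the function for the node \<open>M\<close>. Since \<open>\<sigma>\<close> is
  the smallest slope of \<open>g\<close>, the difference \<open>h s = g s - \<sigma> * s\<close> is still nondecreasing; it is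
  concave, and \<open>h M = h p\<close>. So the induction hypothesis applies to \<open>h\<close> on the other nodes, and the
  combination that it yields is correct at \<open>M\<close> too, because it is constant from \<open>p\<close> on. The node
  \<open>0\<close> is included in the hypotheses so that \<open>g s / s\<close> needs no condition of its own.
\<close>

lemma concave_eq_sum_min:
  fixes g :: "real \<Rightarrow> real"
  assumes "finite S" and "\<And>s. s \<in> S \<Longrightarrow> 0 < s" and "g 0 = 0"
    and "\<And>s t. s \<in> insert 0 S \<Longrightarrow> t \<in> insert 0 S \<Longrightarrow> s \<le> t \<Longrightarrow> g s \<le> g t"
    and "\<And>r s t. r \<in> insert 0 S \<Longrightarrow> s \<in> insert 0 S \<Longrightarrow> t \<in> insert 0 S \<Longrightarrow> r \<le> s \<Longrightarrow> s \<le> t \<Longrightarrow>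
      (g t - g s) * (s - r) \<le> (g s - g r) * (t - s)"
  shows "\<exists>c. (\<forall>t\<in>S. 0 \<le> c t) \<and> (\<forall>s\<in>S. g s = (\<Sum>t\<in>S. c t * min 1 (s / t)))"
  using assms
proof (induction S arbitrary: g rule: finite_linorder_max_induct)
  case empty
  show ?case
    by simp
next
  case (insert M S)
  note pos = insert.prems(1) and g0 = insert.prems(2)
    and mono = insert.prems(3) and conc = insert.prems(4)
  define p where "p = Max (insert 0 S)"
  define \<sigma> where "\<sigma> = (g M - g p) / (M - p)"
  define h where "h s = g s - \<sigma> * s" for s
  have p: "p \<in> insert 0 S" and p_max: "\<And>t. t \<in> insert 0 S \<Longrightarrow> t \<le> p"
    unfolding p_def using Max_in[of "insert 0 S"] insert.hyps(1) by auto
  have "0 < M"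
    using pos by simp
  with p insert.hyps(2) have "p < M"
    by auto
  then have slope: "\<sigma> * (M - p) = g M - g p"
    by (simp add: \<sigma>_def)
  have "0 \<le> \<sigma>"
    unfolding \<sigma>_def using mono[of p M] p \<open>p < M\<close> by auto
  have h_mono: "h s \<le> h t" if st: "s \<in> insert 0 S" "t \<in> insert 0 S" "s \<le> t" for s t
  proof -
    have "t \<le> p"
      using p_max st by blast
    \<comment> \<open>The slopes over \<open>[s, t]\<close>, \<open>[t, M]\<close> and \<open>[p, M]\<close> are nonincreasing; the last one is \<open>\<sigma>\<close>.\<close>
    have "(g M - g p) * (p - t) \<le> (g p - g t) * (M - p)"
      using conc[of t p M] st p \<open>t \<le> p\<close> \<open>p < M\<close> by auto
    then have "(\<sigma> * (p - t)) * (M - p) \<le> (g p - g t) * (M - p)"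
      by (simp add: slope[symmetric] mult_ac)
    then have "\<sigma> * (p - t) \<le> g p - g t"
      using \<open>p < M\<close> by simp
    with slope have "\<sigma> * (M - t) \<le> g M - g t"
      by (simp add: algebra_simps)
    then have "(\<sigma> * (M - t)) * (t - s) \<le> (g M - g t) * (t - s)"
      using st by (intro mult_right_mono) auto
    also have "\<dots> \<le> (g t - g s) * (M - t)"
      using conc[of s t M] st \<open>t \<le> p\<close> \<open>p < M\<close> by auto
    finally have "(\<sigma> * (t - s)) * (M - t) \<le> (g t - g s) * (M - t)"
      by (simp add: mult_ac)
    then have "\<sigma> * (t - s) \<le> g t - g s"
      using \<open>t \<le> p\<close> \<open>p < M\<close> by simp
    then show ?thesis
      by (simp add: h_def algebra_simps)
  qed
  have h_conc: "(h t - h s) * (s - r) \<le> (h s - h r) * (t - s)"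
    if "r \<in> insert 0 S" "s \<in> insert 0 S" "t \<in> insert 0 S" "r \<le> s" "s \<le> t" for r s t
  proof -
    have "(g t - g s) * (s - r) \<le> (g s - g r) * (t - s)"
      using conc[of r s t] that by blast
    then show ?thesis
      by (simp add: h_def algebra_simps)
  qed
  obtain c where c: "\<And>t. t \<in> S \<Longrightarrow> 0 \<le> c t"
    and hc: "\<And>s. s \<in> S \<Longrightarrow> h s = (\<Sum>t\<in>S. c t * min 1 (s / t))"
  proof -
    have "h 0 = 0" "\<And>s. s \<in> S \<Longrightarrow> 0 < s"
      using g0 pos by (auto simp: h_def)
    from insert.IH[of h, OF this(2,1) h_mono h_conc] show ?thesis
      using that by blast
  qed
  have "M \<notin> S"
    using insert.hyps(2) by blast
  define c' where "c' = c(M := \<sigma> * M)"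
  have sum: "(\<Sum>t\<in>insert M S. c' t * min 1 (s / t)) =
      \<sigma> * M * min 1 (s / M) + (\<Sum>t\<in>S. c t * min 1 (s / t))" for s
    using insert.hyps(1) \<open>M \<notin> S\<close> by (auto simp: c'_def intro!: sum.cong)
  \<comment> \<open>From the largest node \<open>p\<close> of the smaller set on, the combination for \<open>h\<close> is constant.\<close>
  have hp: "(\<Sum>t\<in>S. c t * min 1 (s / t)) = h p" if "p \<le> s" for s
  proof (cases "S = {}")
    case True
    then show ?thesis
      using p g0 by (simp add: h_def)
  next
    case False
    then obtain t where "t \<in> S"
      by blast
    then have "p \<noteq> 0"
      using p_max[of t] pos[of t] by auto
    then have "p \<in> S"
      using p by simp
    have "min 1 (s / t) = 1" "min 1 (p / t) = 1" if "t \<in> S" for t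
      using p_max[of t] pos[of t] that \<open>p \<le> s\<close> by (auto simp: min_def field_simps)
    then show ?thesis
      using hc[OF \<open>p \<in> S\<close>] by simp
  qed
  have "g s = (\<Sum>t\<in>insert M S. c' t * min 1 (s / t))" if "s \<in> insert M S" for s
  proof (cases "s = M")
    case True
    have "g M = \<sigma> * M + h p"
      using slope by (simp add: h_def algebra_simps)
    then show ?thesis
      unfolding sum using hp[of M] True \<open>p < M\<close> \<open>0 < M\<close> by simp
  next
    case False
    then have "s \<in> S" "s < M"
      using that insert.hyps(2) by auto
    then show ?thesis
      unfolding sum using hc[of s] \<open>0 < M\<close> by (simp add: h_def min_def field_simps)
  qed
  moreover have "\<forall>t\<in>insert M S. 0 \<le> c' t"
    using c \<open>0 \<le> \<sigma>\<close> \<open>0 < M\<close> by (auto simp: c'_def)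
  ultimately show ?case
    by blast
qed

section \<open>The inequalities describing the closed cone\<close>

text \<open>
  The entries up to \<open>m\<close> are samples of a nonnegative nondecreasing concave function vanishing at
  \<open>0\<close>, taken at the points \<open>1 / x $ i\<close>, and the entries after \<open>m\<close> are a common upper bound. All
  conditions are weak linear inequalities or equations in \<open>B\<close>, which makes closedness and stability
  under nonnegative combinations immediate.
\<close>

definition concave_profile :: "real ^ 'n::{finite,linorder} \<Rightarrow> 'n::{finite,linorder} \<Rightarrow> real ^ 'n::{finite,linorder} \<Rightarrow> bool" where
  "concave_profile x m B \<longleftrightarrow>
    (\<forall>i. m < i \<longrightarrow> B $ m \<le> B $ i) \<and> (\<forall>i j. m < i \<longrightarrow> m < j \<longrightarrow> B $ i = B $ j) \<and>
    (\<forall>i. i \<le> m \<longrightarrow> 0 \<le> B $ i) \<and>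
    (\<forall>i j. i \<le> j \<longrightarrow> j \<le> m \<longrightarrow> B $ i \<le> B $ j \<and> B $ j * (1 / x $ i) \<le> B $ i * (1 / x $ j)) \<and>
    (\<forall>i j k. i \<le> j \<longrightarrow> j \<le> k \<longrightarrow> k \<le> m \<longrightarrow>
      (B $ k - B $ j) * (1 / x $ j - 1 / x $ i) \<le> (B $ j - B $ i) * (1 / x $ k - 1 / x $ j))"

lemma closed_concave_profile: "closed {B. concave_profile x m B}"
  unfolding concave_profile_def
  by (intro closed_Collect_conj closed_Collect_all closed_Collect_imp closed_Collect_le
      closed_Collect_eq open_Collect_const continuous_intros)

lemma concave_profile_zero: "concave_profile x m 0"
  by (simp add: concave_profile_def)

lemma concave_profileI:
  assumes "\<And>i. m < i \<Longrightarrow> B $ m \<le> B $ i"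
    and "\<And>i j. m < i \<Longrightarrow> m < j \<Longrightarrow> B $ i = B $ j"
    and "\<And>i. i \<le> m \<Longrightarrow> 0 \<le> B $ i"
    and "\<And>i j. i \<le> j \<Longrightarrow> j \<le> m \<Longrightarrow> B $ i \<le> B $ j"
    and "\<And>i j. i \<le> j \<Longrightarrow> j \<le> m \<Longrightarrow> B $ j * (1 / x $ i) \<le> B $ i * (1 / x $ j)"
    and "\<And>i j k. i \<le> j \<Longrightarrow> j \<le> k \<Longrightarrow> k \<le> m \<Longrightarrow>
      (B $ k - B $ j) * (1 / x $ j - 1 / x $ i) \<le> (B $ j - B $ i) * (1 / x $ k - 1 / x $ j)"
  shows "concave_profile x m B"
  unfolding concave_profile_def by (intro conjI allI impI; rule assms)

lemma concave_profileD:
  assumes "concave_profile x m B"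
  shows "m < i \<Longrightarrow> B $ m \<le> B $ i"
    and "m < i \<Longrightarrow> m < j \<Longrightarrow> B $ i = B $ j"
    and "i \<le> m \<Longrightarrow> 0 \<le> B $ i"
    and "i \<le> j \<Longrightarrow> j \<le> m \<Longrightarrow> B $ i \<le> B $ j"
    and "i \<le> j \<Longrightarrow> j \<le> m \<Longrightarrow> B $ j * (1 / x $ i) \<le> B $ i * (1 / x $ j)"
    and "i \<le> j \<Longrightarrow> j \<le> k \<Longrightarrow> k \<le> m \<Longrightarrow>
      (B $ k - B $ j) * (1 / x $ j - 1 / x $ i) \<le> (B $ j - B $ i) * (1 / x $ k - 1 / x $ j)"
proof -
  note D = assms[unfolded concave_profile_def]
  show "m < i \<Longrightarrow> B $ m \<le> B $ i"
    using D[THEN conjunct1] by iprover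
  show "m < i \<Longrightarrow> m < j \<Longrightarrow> B $ i = B $ j"
    using D[THEN conjunct2, THEN conjunct1] by iprover
  show "i \<le> m \<Longrightarrow> 0 \<le> B $ i"
    using D[THEN conjunct2, THEN conjunct2, THEN conjunct1] by iprover
  show "i \<le> j \<Longrightarrow> j \<le> m \<Longrightarrow> B $ i \<le> B $ j"
    and "i \<le> j \<Longrightarrow> j \<le> m \<Longrightarrow> B $ j * (1 / x $ i) \<le> B $ i * (1 / x $ j)"
    using D[THEN conjunct2, THEN conjunct2, THEN conjunct2, THEN conjunct1] by iprover+
  show "i \<le> j \<Longrightarrow> j \<le> k \<Longrightarrow> k \<le> m \<Longrightarrow>
      (B $ k - B $ j) * (1 / x $ j - 1 / x $ i) \<le> (B $ j - B $ i) * (1 / x $ k - 1 / x $ j)"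
    using D[THEN conjunct2, THEN conjunct2, THEN conjunct2, THEN conjunct2] by iprover
qed

lemma concave_profile_add_scaleR:
  assumes v: "concave_profile x m v" and w: "concave_profile x m w" and a: "0 \<le> a"
  shows "concave_profile x m (v + a *\<^sub>R w)"
proof -
  have comb: "v1 + a * w1 \<le> v2 + a * w2" if "v1 \<le> v2" "w1 \<le> w2" for v1 v2 w1 w2
    using that(1) mult_left_mono[OF that(2) a] by (rule add_mono)
  have nth: "(v + a *\<^sub>R w) $ i = v $ i + a * w $ i" for i
    by simp
  have scale: "(v1 + a * w1) * y = v1 * y + a * (w1 * y)"
    and diff: "(v1 + a * w1) - (v2 + a * w2) = (v1 - v2) + a * (w1 - w2)" for v1 v2 w1 w2 y
    by (simp_all add: algebra_simps)
  note V = concave_profileD[OF v] and W = concave_profileD[OF w]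
  show ?thesis
  proof (rule concave_profileI; unfold nth diff scale)
    show "v $ m + a * w $ m \<le> v $ i + a * w $ i" if "m < i" for i
      by (intro comb V(1) W(1) that)
    show "v $ i + a * w $ i = v $ j + a * w $ j" if "m < i" "m < j" for i j
      using V(2)[OF that] W(2)[OF that] by simp
    show "0 \<le> v $ i + a * w $ i" if "i \<le> m" for i
      using V(3)[OF that] W(3)[OF that] a by simp
    show "v $ i + a * w $ i \<le> v $ j + a * w $ j" if "i \<le> j" "j \<le> m" for i j
      by (intro comb V(4) W(4) that)
    show "v $ j * (1 / x $ i) + a * (w $ j * (1 / x $ i))
        \<le> v $ i * (1 / x $ j) + a * (w $ i * (1 / x $ j))"
      if "i \<le> j" "j \<le> m" for i j
      by (intro comb V(5) W(5) that)
    show "(v $ k - v $ j) * (1 / x $ j - 1 / x $ i) + a * ((w $ k - w $ j) * (1 / x $ j - 1 / x $ i))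
        \<le> (v $ j - v $ i) * (1 / x $ k - 1 / x $ j) + a * ((w $ j - w $ i) * (1 / x $ k - 1 / x $ j))"
      if "i \<le> j" "j \<le> k" "k \<le> m" for i j k
      by (intro comb V(6) W(6) that)
  qed
qed

context
  fixes x :: "real ^ 'n::{finite,linorder}" and m :: 'n
  assumes cone: "x \<in> D_cone"
    and pos: "\<And>i. i \<le> m \<Longrightarrow> 0 < x $ i"
    and zero: "\<And>i. m < i \<Longrightarrow> x $ i = 0"
begin

lemma inverse_coordinate_pos: "i \<le> m \<Longrightarrow> 0 < 1 / x $ i"
  using pos by simp

lemma inverse_coordinate_mono: "i \<le> j \<Longrightarrow> j \<le> m \<Longrightarrow> 1 / x $ i \<le> 1 / x $ j"
  using cone pos[of j] unfolding D_cone_def by (intro frac_le) auto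

text \<open>
  Concavity of \<open>s \<mapsto> min 1 (l * s)\<close> at positive nodes gives the condition on triples, and at the
  nodes \<open>0 \<le> 1 / x $ i \<le> 1 / x $ j\<close> it gives the condition on ratios.
\<close>

lemma concave_profile_gradient:
  assumes l: "0 < l"
  shows "concave_profile x m (gradient (Psi l) x)"
proof -
  have grad: "gradient (Psi l) x $ i = min 1 (l * (1 / x $ i))" if "i \<le> m" for i
    using gradient_Psi_nth_pos[OF l] pos that by blast
  have tail: "gradient (Psi l) x $ i = 1" if "m < i" for i
    using gradient_Psi_nth_zero[OF l] zero that by blast
  show ?thesis
  proof (rule concave_profileI)
    show "gradient (Psi l) x $ m \<le> gradient (Psi l) x $ i" if "m < i" for i
      by (simp add: grad tail that)
    show "gradient (Psi l) x $ i = gradient (Psi l) x $ j" if "m < i" "m < j" for i j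
      by (simp add: tail that)
    show "0 \<le> gradient (Psi l) x $ i" if "i \<le> m" for i
      using l inverse_coordinate_pos[OF that] by (simp add: grad that)
  next
    fix i j
    assume ij: "i \<le> j" "j \<le> m"
    then have im: "i \<le> m"
      by simp
    have min_zero: "min 1 (l * 0) = 0"
      by simp
    have ratio: "v * p \<le> u * q" if "(v - u) * (p - 0) \<le> (u - 0) * (q - p)" for u v p q :: real
      using that by (simp add: left_diff_distrib right_diff_distrib)
    note y = inverse_coordinate_pos[OF im] inverse_coordinate_mono[OF ij]
    have "l * (1 / x $ i) \<le> l * (1 / x $ j)"
      using y l by (intro mult_left_mono) auto
    then show "gradient (Psi l) x $ i \<le> gradient (Psi l) x $ j"
      unfolding grad[OF im] grad[OF ij(2)] by (rule min.mono[OF order_refl])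
    show "gradient (Psi l) x $ j * (1 / x $ i) \<le> gradient (Psi l) x $ i * (1 / x $ j)"
      unfolding grad[OF im] grad[OF ij(2)]
      by (rule ratio[OF min_linear_concave[OF l less_imp_le[OF y(1)] y(2), unfolded min_zero]])
  next
    fix i j k
    assume ijk: "i \<le> j" "j \<le> k" "k \<le> m"
    then have le: "i \<le> m" "j \<le> m"
      by auto
    show "(gradient (Psi l) x $ k - gradient (Psi l) x $ j) * (1 / x $ j - 1 / x $ i)
        \<le> (gradient (Psi l) x $ j - gradient (Psi l) x $ i) * (1 / x $ k - 1 / x $ j)"
      unfolding grad[OF le(1)] grad[OF le(2)] grad[OF ijk(3)]
      using ijk le by (intro min_linear_concave l inverse_coordinate_mono)
  qed
qed

lemma closure_C_Psi_imp_concave_profile: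
  assumes "B \<in> closure (C_Psi x)"
  shows "concave_profile x m B"
proof -
  have "concave_profile x m v" if "v \<in> C_Psi x" for v
    using that
  proof (induction rule: C_Psi_induct)
    case zero
    show ?case
      by (rule concave_profile_zero)
  next
    case (add v a l)
    then show ?case
      by (intro concave_profile_add_scaleR concave_profile_gradient)
  qed
  then have "closure (C_Psi x) \<subseteq> {B. concave_profile x m B}"
    by (intro closure_minimal closed_concave_profile) auto
  with assms show ?thesis
    by blast
qed

text \<open>
  The samples define a function on the node set \<open>S\<close> because equal nodes carry equal values:
  monotonicity gives one inequality and the ratio condition the other. The function
  \<open>s \<mapsto> min 1 (s / t)\<close> is realised by the gradient with parameter \<open>1 / t\<close>, and since it equals \<open>1\<close>
  at the largest node \<open>1 / x $ m\<close> already, the sum takes the value \<open>B $ m\<close> on the zero coordinates.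
\<close>

lemma concave_profile_imp_sum_gradient:
  assumes B: "concave_profile x m B"
  shows "\<exists>w\<in>C_Psi x. (\<forall>i\<le>m. w $ i = B $ i) \<and> (\<forall>i>m. w $ i = B $ m)"
proof -
  define y where "y i = 1 / x $ i" for i
  define S where "S = y ` {..m}"
  \<comment> \<open>Any choice of an index for each node is automatically monotone, as \<open>y\<close> is.\<close>
  define f where "f = inv_into {..m} y"
  define g where "g s = (if s = 0 then 0 else B $ f s)" for s
  have y_pos: "0 < y i" if "i \<le> m" for i
    unfolding y_def using inverse_coordinate_pos that .
  have y_mono: "y i \<le> y j" if "i \<le> j" "j \<le> m" for i j
    unfolding y_def using inverse_coordinate_mono that .
  have S_pos: "0 < s" if "s \<in> S" for s
    using that y_pos by (auto simp: S_def)
  have f: "f s \<le> m" "y (f s) = s" if "s \<in> S" for s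
    using inv_into_into[of s y "{..m}"] f_inv_into_f[of s y "{..m}"] that
    by (auto simp: S_def f_def)
  have f_mono: "f s \<le> f t" if "s \<in> S" "t \<in> S" "s \<le> t" for s t
  proof (cases "s = t")
    case False
    show ?thesis
    proof (rule ccontr)
      assume "\<not> f s \<le> f t"
      then have "y (f t) \<le> y (f s)"
        using f[OF that(1)] by (intro y_mono) auto
      with f that False show False
        by auto
    qed
  qed simp
  have B_mono: "B $ i \<le> B $ j" "B $ j * y i \<le> B $ i * y j" if "i \<le> j" "j \<le> m" for i j
    unfolding y_def using concave_profileD(4,5)[OF B] that by blast+
  have gf: "g s = B $ f s" if "s \<in> S" for s
    using S_pos[OF that] by (simp add: g_def)
  have eq_le: "B $ i = B $ j" if "i \<le> j" "j \<le> m" "y i = y j" for i j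
  proof (rule antisym)
    show "B $ i \<le> B $ j"
      by (rule B_mono(1)[OF that(1,2)])
    have "B $ j * y j \<le> B $ i * y j"
      using B_mono(2)[OF that(1,2)] that(3) by simp
    then show "B $ j \<le> B $ i"
      using y_pos[OF that(2)] by simp
  qed
  have eq: "B $ i = B $ j" if "i \<le> m" "j \<le> m" "y i = y j" for i j
    using linear[of i j] eq_le[of i j] eq_le[of j i] that by metis
  have gy: "g (y i) = B $ i" if "i \<le> m" for i
  proof -
    have yS: "y i \<in> S"
      using that by (simp add: S_def)
    show ?thesis
      unfolding gf[OF yS] by (rule eq[OF f(1)[OF yS] that f(2)[OF yS]])
  qed
  have g_mono: "g s \<le> g t" if st: "s \<in> insert 0 S" "t \<in> insert 0 S" "s \<le> t" for s t
  proof (cases "s = 0")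
    case True
    have "0 \<le> B $ f t" if "t \<in> S"
      using concave_profileD(3)[OF B] f(1)[OF that] .
    then show ?thesis
      using st True by (auto simp: g_def)
  next
    case False
    then have "s \<in> S" "t \<in> S"
      using st S_pos[of s] by auto
    then show ?thesis
      using B_mono(1)[OF f_mono f(1)] st gf by simp
  qed
  have g_conc: "(g t - g s) * (s - r) \<le> (g s - g r) * (t - s)"
    if rst: "r \<in> insert 0 S" "s \<in> insert 0 S" "t \<in> insert 0 S" "r \<le> s" "s \<le> t" for r s t
  proof (cases "s = 0")
    case True
    then have "r = 0"
      using rst S_pos[of r] by auto
    then show ?thesis
      using True by simp
  next
    case False
    then have S: "s \<in> S" "t \<in> S"
      using rst S_pos[of s] by auto
    show ?thesis
    proof (cases "r = 0")
      case True
      have "g t * s \<le> g s * t"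
        using B_mono(2)[OF f_mono f(1), of s t] S rst f gf by simp
      then show ?thesis
        using True by (simp add: g_def algebra_simps)
    next
      case False
      then have "r \<in> S"
        using rst by simp
      have "(B $ f t - B $ f s) * (y (f s) - y (f r)) \<le> (B $ f s - B $ f r) * (y (f t) - y (f s))"
        unfolding y_def
        by (rule concave_profileD(6)[OF B f_mono[OF \<open>r \<in> S\<close> S(1)] f_mono[OF S] f(1)[OF S(2)]])
          (use rst in auto)
      then show ?thesis
        using S \<open>r \<in> S\<close> f gf by simp
    qed
  qed
  have fin: "finite S"
    by (simp add: S_def)
  obtain c where c: "\<And>t. t \<in> S \<Longrightarrow> 0 \<le> c t"
    and gc: "\<And>s. s \<in> S \<Longrightarrow> g s = (\<Sum>t\<in>S. c t * min 1 (s / t))"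
  proof -
    have "g 0 = 0"
      by (simp add: g_def)
    from concave_eq_sum_min[OF fin S_pos this g_mono g_conc] show ?thesis
      using that by blast
  qed
  define w where "w = (\<Sum>t\<in>S. c t *\<^sub>R gradient (Psi (1 / t)) x)"
  have "w \<in> C_Psi x"
    unfolding w_def using fin c S_pos by (intro sum_gradient_mem_C_Psi) auto
  moreover have "w $ i = B $ i" if "i \<le> m" for i
  proof -
    have "w $ i = (\<Sum>t\<in>S. c t * min 1 (y i / t))"
      unfolding w_def using S_pos pos[OF that]
      by (auto simp: gradient_Psi_nth_pos y_def mult.commute intro!: sum.cong)
    also have "\<dots> = B $ i"
      using gc[of "y i"] gy that by (simp add: S_def)
    finally show ?thesis .
  qed
  moreover have "w $ i = B $ m" if "m < i" for i
  proof -
    have "w $ i = (\<Sum>t\<in>S. c t)"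
      unfolding w_def using S_pos zero[OF that]
      by (auto simp: gradient_Psi_nth_zero intro!: sum.cong)
    also have "\<dots> = (\<Sum>t\<in>S. c t * min 1 (y m / t))"
    proof (rule sum.cong)
      fix t assume t: "t \<in> S"
      then have "t \<le> y m"
        using y_mono by (auto simp: S_def)
      then show "c t = c t * min 1 (y m / t)"
        using S_pos[OF t] by simp
    qed simp
    also have "\<dots> = B $ m"
      using gc[of "y m"] gy[of m] by (simp add: S_def)
    finally show ?thesis .
  qed
  ultimately show ?thesis
    by blast
qed

text \<open>
  As \<open>l\<close> tends to \<open>0\<close>, the gradients with parameter \<open>l\<close> tend to the indicator of the zero
  coordinates of \<open>x\<close>; adding a multiple \<open>e\<close> of them raises the value there from \<open>B $ m\<close> to that of \<open>B\<close>
  and leaves the other entries unchanged in the limit.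
\<close>

lemma concave_profile_imp_closure_C_Psi:
  assumes B: "concave_profile x m B"
  shows "B \<in> closure (C_Psi x)"
proof -
  obtain w where w: "w \<in> C_Psi x" "\<And>i. i \<le> m \<Longrightarrow> w $ i = B $ i" "\<And>i. m < i \<Longrightarrow> w $ i = B $ m"
    using concave_profile_imp_sum_gradient[OF B] by blast
  have "\<exists>e\<ge>0. \<forall>i>m. B $ i = B $ m + e"
  proof (cases "\<exists>j. m < j")
    case True
    then obtain j where j: "m < j" ..
    have "B $ i = B $ j" if "m < i" for i
      using concave_profileD(2)[OF B that j] .
    moreover have "B $ m \<le> B $ j"
      using concave_profileD(1)[OF B j] .
    ultimately show ?thesis
      by (intro exI[of _ "B $ j - B $ m"]) auto
  qed auto
  then obtain e where e: "0 \<le> e" "\<And>i. m < i \<Longrightarrow> B $ i = B $ m + e"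
    by blast
  define l :: "nat \<Rightarrow> real" where "l n = inverse (real (Suc n))" for n
  have l: "0 < l n" for n
    by (simp add: l_def)
  have "(\<lambda>n. w + e *\<^sub>R gradient (Psi (l n)) x) \<longlonglongrightarrow> B"
  proof (rule vec_tendstoI)
    fix i
    show "(\<lambda>n. (w + e *\<^sub>R gradient (Psi (l n)) x) $ i) \<longlonglongrightarrow> B $ i"
    proof (cases "i \<le> m")
      case True
      have "(\<lambda>n. B $ i + e * min 1 (l n * (1 / x $ i))) \<longlonglongrightarrow> B $ i + e * min 1 (0 * (1 / x $ i))"
        unfolding l_def by (intro tendsto_intros LIMSEQ_inverse_real_of_nat)
      then show ?thesis
        using True w pos[OF True] l by (simp add: gradient_Psi_nth_pos)
    next
      case False
      then show ?thesis
        using w e zero[of i] l by (simp add: gradient_Psi_nth_zero)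
    qed
  qed
  moreover have "w + e *\<^sub>R gradient (Psi (l n)) x \<in> C_Psi x" for n
    using w(1) e(1) l by (rule add_gradient_mem_C_Psi)
  ultimately show ?thesis
    unfolding closure_sequential
    by (intro exI[of _ "\<lambda>n. w + e *\<^sub>R gradient (Psi (l n)) x"] conjI allI)
qed

text \<open>
  The conditions on single entries and on pairs come from the triples with repeated indices.
\<close>

lemma concave_profile_iff_totally_positive:
  "concave_profile x m B \<longleftrightarrow>
    ((\<forall>i. m < i \<longrightarrow> B $ m \<le> B $ i) \<and> (\<forall>i j. m < i \<longrightarrow> m < j \<longrightarrow> B $ i = B $ j)) \<and>
    (\<forall>i j k. i \<le> j \<longrightarrow> j \<le> k \<longrightarrow> k \<le> m \<longrightarrow>
       totally_positive (mat_of_rows_list 3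
         [[1, 1, 1], [B $ i, B $ j, B $ k], [1 / x $ i, 1 / x $ j, 1 / x $ k]]))"
    (is "_ \<longleftrightarrow> ?tail \<and> ?tp")
proof -
  have tp: "totally_positive (mat_of_rows_list 3
         [[1, 1, 1], [B $ i, B $ j, B $ k], [1 / x $ i, 1 / x $ j, 1 / x $ k]]) \<longleftrightarrow>
      (0 \<le> B $ i \<and> B $ i \<le> B $ j \<and> B $ j \<le> B $ k) \<and>
      (B $ j * (1 / x $ i) \<le> B $ i * (1 / x $ j) \<and> B $ k * (1 / x $ i) \<le> B $ i * (1 / x $ k) \<and>
       B $ k * (1 / x $ j) \<le> B $ j * (1 / x $ k)) \<and>
      (B $ k - B $ j) * (1 / x $ j - 1 / x $ i) \<le> (B $ j - B $ i) * (1 / x $ k - 1 / x $ j)"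
    if "i \<le> j" "j \<le> k" "k \<le> m" for i j k
    by (rule totally_positive_concave_iff)
      (use that inverse_coordinate_pos inverse_coordinate_mono in auto)
  show ?thesis
  proof
    assume B: "concave_profile x m B"
    have ?tp
    proof (intro allI impI)
      fix i j k
      assume *: "i \<le> j" "j \<le> k" "k \<le> m"
      then have "j \<le> m" "i \<le> k" "i \<le> m"
        by auto
      with * show "totally_positive (mat_of_rows_list 3
         [[1, 1, 1], [B $ i, B $ j, B $ k], [1 / x $ i, 1 / x $ j, 1 / x $ k]])"
        unfolding tp[OF *] by (intro conjI concave_profileD[OF B])
    qed
    moreover have ?tail
      using concave_profileD(1,2)[OF B] by iprover
    ultimately show "?tail \<and> ?tp"
      by blast
  next
    assume R: "?tail \<and> ?tp"
    have minor: "(0 \<le> B $ i \<and> B $ i \<le> B $ j \<and> B $ j \<le> B $ k) \<and>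
      (B $ j * (1 / x $ i) \<le> B $ i * (1 / x $ j) \<and> B $ k * (1 / x $ i) \<le> B $ i * (1 / x $ k) \<and>
       B $ k * (1 / x $ j) \<le> B $ j * (1 / x $ k)) \<and>
      (B $ k - B $ j) * (1 / x $ j - 1 / x $ i) \<le> (B $ j - B $ i) * (1 / x $ k - 1 / x $ j)"
      if "i \<le> j" "j \<le> k" "k \<le> m" for i j k
      using R[THEN conjunct2] that unfolding tp[OF that, symmetric] by iprover
    show "concave_profile x m B"
    proof (rule concave_profileI)
      show "B $ m \<le> B $ i" if "m < i" for i
        using R[THEN conjunct1, THEN conjunct1] that by iprover
      show "B $ i = B $ j" if "m < i" "m < j" for i j
        using R[THEN conjunct1, THEN conjunct2] that by iprover
      show "0 \<le> B $ i" if "i \<le> m" for i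
        using minor[OF order_refl order_refl that] by iprover
      show "B $ i \<le> B $ j" "B $ j * (1 / x $ i) \<le> B $ i * (1 / x $ j)"
        if "i \<le> j" "j \<le> m" for i j
        using minor[OF that(1) order_refl that(2)] by iprover+
      show "(B $ k - B $ j) * (1 / x $ j - 1 / x $ i) \<le> (B $ j - B $ i) * (1 / x $ k - 1 / x $ j)"
        if "i \<le> j" "j \<le> k" "k \<le> m" for i j k
        using minor[OF that] by iprover
    qed
  qed
qed

end

theorem lemma12:
  fixes x B :: "real ^ 'n::{finite,linorder}" and m :: 'n
  assumes "x \<in> D_cone" and "x \<noteq> 0"
    and "\<forall>i. i \<le> m \<longrightarrow> 0 < x $ i" and "\<forall>i. m < i \<longrightarrow> x $ i = 0"
  shows "B \<in> closure (C_Psi x) \<longleftrightarrow>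
    ((\<forall>i. m < i \<longrightarrow> B $ m \<le> B $ i) \<and> (\<forall>i j. m < i \<longrightarrow> m < j \<longrightarrow> B $ i = B $ j)) \<and>
    (\<forall>i j k. i \<le> j \<longrightarrow> j \<le> k \<longrightarrow> k \<le> m \<longrightarrow>
       totally_positive (mat_of_rows_list 3
         [[1, 1, 1],
          [B $ i, B $ j, B $ k],
          [1 / x $ i, 1 / x $ j, 1 / x $ k]]))"
  using closure_C_Psi_imp_concave_profile[of x m B] concave_profile_imp_closure_C_Psi[of x m B]
    concave_profile_iff_totally_positive[of x m B] assms
  by blast

end
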